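(* Let $\ell_1,\ell_2,\ell_3,\ell_4$ be pairwise skew lines in $\mathbb{P}^3$ (over $\mathbb{C}$), and suppose that there is a unique line $\ell\subset\mathbb{P}^3$ that intersects all of $\ell_1,\ell_2,\ell_3,\ell_4$. Let $\pi\colon Y\to\mathbb{P}^3$ be the blow up of $\ell$, with exceptional divisor $E\cong\mathbb{P}^1\times\mathbb{P}^1$, and let $\tilde{\ell}_1,\ldots,\tilde{\ell}_4$ be the proper transforms on $Y$ of $\ell_1,\ldots,\ell_4$. Then there exists a unique curve $C\subset E$ of bi-degree $(1,1)$ that intersects each of $\tilde{\ell}_1,\tilde{\ell}_2,\tilde{\ell}_3,\tilde{\ell}_4$. *)

theory Defs
  imports "HOL-Analysis.Analysis"
begin

text \<open>Concrete model of projective 3-space over the complex numbers.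
  A point of P^3 is represented by any nonzero vector of complex^4 (all sets below
  are closed under nonzero rescaling of representatives). A line of P^3 is a
  2-dimensional complex linear subspace of complex^4.\<close>

definition pairing :: "complex^4 \<Rightarrow> complex^4 \<Rightarrow> complex" where
  "pairing w x = (\<Sum>i\<in>UNIV. w$i * x$i)"

definition cspan2 :: "complex^4 \<Rightarrow> complex^4 \<Rightarrow> (complex^4) set" where
  "cspan2 u v = {a *s u + b *s v | a b. True}"

definition is_line :: "(complex^4) set \<Rightarrow> bool" where
  "is_line L \<longleftrightarrow> (\<exists>u v. (\<forall>a b. a *s u + b *s v = 0 \<longrightarrow> a = 0 \<and> b = 0) \<and> L = cspan2 u v)"

text \<open>Two lines meet in P^3 iff their subspaces share a nonzero vector.\<close>
definition meets :: "(complex^4) set \<Rightarrow> (complex^4) set \<Rightarrow> bool" where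
  "meets L M \<longleftrightarrow> L \<inter> M \<noteq> {0}"

text \<open>Linear forms vanishing on a line; nonzero ones, up to scaling, are the planes
  containing the line.\<close>
definition ann :: "(complex^4) set \<Rightarrow> (complex^4) set" where
  "ann L = {w. \<forall>x\<in>L. pairing w x = 0}"

text \<open>Blow-up of P^3 along the line l: pairs (point x, plane ker w \<supseteq> l) with x in the plane.
  The projection is (x,w) \<mapsto> x.\<close>
definition blowup :: "(complex^4) set \<Rightarrow> ((complex^4) \<times> (complex^4)) set" where
  "blowup l = {(x, w). x \<noteq> 0 \<and> w \<noteq> 0 \<and> w \<in> ann l \<and> pairing w x = 0}"

text \<open>Exceptional divisor: preimage of l (isomorphic to l \<times> pencil of planes = P^1 \<times> P^1).\<close>
definition exc_div :: "(complex^4) set \<Rightarrow> ((complex^4) \<times> (complex^4)) set" where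
  "exc_div l = {p \<in> blowup l. fst p \<in> l}"

text \<open>Proper transform of a curve L: closure (classical topology, which agrees with the
  Zariski closure here) of the preimage of L minus l.\<close>
definition proper_transform ::
  "(complex^4) set \<Rightarrow> (complex^4) set \<Rightarrow> ((complex^4) \<times> (complex^4)) set" where
  "proper_transform l L = closure {p \<in> blowup l. fst p \<in> L - l} \<inter> blowup l"

text \<open>Curves of bidegree (1,1) on E: zero loci of a bilinear form on l \<times> ann l
  (bihomogeneous of degree (1,1) in the point of l and the plane through l),
  not identically zero.\<close>
definition curve11 :: "(complex^4) set \<Rightarrow> ((complex^4) \<times> (complex^4)) set \<Rightarrow> bool" where
  "curve11 l C \<longleftrightarrow> (\<exists>M :: complex^4^4.
      (\<exists>x\<in>l. \<exists>w\<in>ann l. pairing w (M *v x) \<noteq> 0) \<and>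
      C = {(x, w) \<in> exc_div l. pairing w (M *v x) = 0})"

end

theory Submission
  imports Defs
begin

(*
  Choose a basis a, b, c, d of C^4 with l = span{a, b} and let ea, eb, ec, ed be the dual basis. Then the
  exceptional divisor E is l x (pencil of planes through l) = P^1 x P^1, and a curve of bidegree (1,1) on E
  is the zero set of a bilinear form with coefficient vector n in C^4. If l_i meets l at p_i and contains
  q_i outside l, the proper transform of l_i meets E exactly at (p_i, the plane spanned by l and q_i).
  Skewness of the l_i makes the four points p_i pairwise distinct on l and the four planes pairwise
  distinct in the pencil.

  Uniqueness: by Lagrange interpolation in each factor, a (1,1)-form vanishing at three such points is
  determined up to a scalar.

  Existence: the lines disjoint from l are the graphs of the linear maps span{c, d} -> l, parametrised
  by n in C^4, and such a graph meets l_i iff an affine equation in n holds whose linear part is the form n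
  evaluated at the i-th point of E. If no nonzero form vanished at all four points, this 4 x 4 system
  would be solvable, giving a second line meeting l_1, ..., l_4.
*)

section \<open>Linear algebra in dimension four\<close>

lemma UNIV_eq_distinct4:
  assumes "distinct [i, j, k, m :: 4]"
  shows "UNIV = {i, j, k, m}"
proof -
  have "card {i, j, k, m} = CARD(4)"
    using assms by simp
  then show ?thesis
    by (metis card_subset_eq finite subset_UNIV)
qed

lemma sum_UNIV_distinct4:
  "distinct [i, j, k, m :: 4] \<Longrightarrow> (\<Sum>n\<in>UNIV. f n) = f i + f j + f k + f m"
  by (simp add: UNIV_eq_distinct4 add.assoc)

lemma card_less_ex_notin: "card (A :: 'a::finite set) < CARD('a) \<Longrightarrow> \<exists>k. k \<notin> A"
  by (metis UNIV_I less_irrefl subsetI subset_antisym)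

lemma distinct4_extend:
  assumes "(i::4) \<noteq> j"
  shows "\<exists>k m. distinct [i, j, k, m]"
proof -
  have "card {i, j} < CARD(4)"
    using assms by (simp add: card_insert_if)
  then obtain k where k: "k \<notin> {i, j}"
    using card_less_ex_notin by blast
  have "card {i, j, k} < CARD(4)"
    using assms k by (simp add: card_insert_if)
  then obtain m where m: "m \<notin> {i, j, k}"
    using card_less_ex_notin by blast
  show ?thesis
    using assms k m by auto
qed

lemma matrix_vector_mult_smult: "(M :: 'a::comm_semiring_1^'n^'m) *v (c *s x) = c *s (M *v x)"
  by (simp add: vec_eq_iff matrix_vector_mult_def sum_distrib_left algebra_simps)

lemma square_system_alternative:
  fixes A :: "'a::field^'n^'n"
  shows "(\<exists>x. x \<noteq> 0 \<and> A *v x = 0) \<or> (\<forall>y. \<exists>x. A *v x = y)"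
proof (rule disjCI)
  assume "\<not> (\<forall>y. \<exists>x. A *v x = y)"
  then have "\<not> surj ((*v) A)"
    by (metis surjD)
  then have "\<not> (\<exists>B. B ** A = mat 1)"
    by (metis matrix_left_right_inverse matrix_right_invertible_surjective)
  then show "\<exists>x. x \<noteq> 0 \<and> A *v x = 0"
    unfolding matrix_left_invertible_ker by blast
qed

definition det2 :: "complex \<Rightarrow> complex \<Rightarrow> complex \<Rightarrow> complex \<Rightarrow> complex" where
  "det2 x1 x2 y1 y2 = x1 * y2 - x2 * y1"

lemma det2_eq_0_proportional:
  assumes "x1 \<noteq> 0 \<or> x2 \<noteq> 0" "det2 x1 x2 y1 y2 = 0"
  shows "\<exists>k. y1 = k * x1 \<and> y2 = k * x2"
proof (cases "x1 = 0")
  case True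
  then show ?thesis
    using assms by (intro exI[of _ "y2 / x2"]) (auto simp: det2_def field_simps)
next
  case False
  then show ?thesis
    using assms by (intro exI[of _ "y1 / x1"]) (auto simp: det2_def field_simps)
qed

lemma cramer2:
  assumes "det2 x1 x2 y1 y2 \<noteq> 0"
  shows "z1 = det2 z1 z2 y1 y2 / det2 x1 x2 y1 y2 * x1 + det2 x1 x2 z1 z2 / det2 x1 x2 y1 y2 * y1"
    and "z2 = det2 z1 z2 y1 y2 / det2 x1 x2 y1 y2 * x2 + det2 x1 x2 z1 z2 / det2 x1 x2 y1 y2 * y2"
  using assms unfolding det2_def by (simp_all add: divide_simps) (simp_all add: algebra_simps)

section \<open>Lines and planes in projective 3-space\<close>

lemma pairing_add_right [simp]: "pairing w (x + y) = pairing w x + pairing w y"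
  by (simp add: pairing_def algebra_simps sum.distrib)

lemma pairing_add_left [simp]: "pairing (w + w') x = pairing w x + pairing w' x"
  by (simp add: pairing_def algebra_simps sum.distrib)

lemma pairing_diff_right [simp]: "pairing w (x - y) = pairing w x - pairing w y"
  by (simp add: pairing_def algebra_simps sum_subtractf)

lemma pairing_diff_left [simp]: "pairing (w - w') x = pairing w x - pairing w' x"
  by (simp add: pairing_def algebra_simps sum_subtractf)

lemma pairing_smult_right [simp]: "pairing w (c *s x) = c * pairing w x"
  by (simp add: pairing_def algebra_simps sum_distrib_left)

lemma pairing_smult_left [simp]: "pairing (c *s w) x = c * pairing w x"
  by (simp add: pairing_def algebra_simps sum_distrib_left)

lemma pairing_zero_right [simp]: "pairing w 0 = 0"
  by (simp add: pairing_def)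

lemma pairing_zero_left [simp]: "pairing 0 x = 0"
  by (simp add: pairing_def)

lemma pairing_axis: "pairing w (axis n 1) = w $ n"
proof -
  have "pairing w (axis n 1) = (\<Sum>i\<in>UNIV. if i = n then w $ i else 0)"
    unfolding pairing_def by (intro sum.cong) (auto simp: axis_def)
  then show ?thesis
    by simp
qed

definition indep :: "complex^4 \<Rightarrow> complex^4 \<Rightarrow> bool" where
  "indep u v \<longleftrightarrow> (\<forall>\<alpha> \<beta>. \<alpha> *s u + \<beta> *s v = 0 \<longrightarrow> \<alpha> = 0 \<and> \<beta> = 0)"

lemma is_line_iff: "is_line L \<longleftrightarrow> (\<exists>u v. indep u v \<and> L = cspan2 u v)"
  by (simp add: is_line_def indep_def)

lemma cspan2_lincomb: "\<alpha> *s u + \<beta> *s v \<in> cspan2 u v"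
  unfolding cspan2_def by blast

lemma cspan2_left: "u \<in> cspan2 u v"
  using cspan2_lincomb[of 1 u 0 v] by simp

lemma cspan2_right: "v \<in> cspan2 u v"
  using cspan2_lincomb[of 0 u 1 v] by simp

lemma cspan2_zero: "0 \<in> cspan2 u v"
  using cspan2_lincomb[of 0 u 0 v] by simp

lemma cspan2_add:
  assumes "x \<in> cspan2 u v" "y \<in> cspan2 u v"
  shows "x + y \<in> cspan2 u v"
proof -
  obtain a1 b1 a2 b2 where "x = a1 *s u + b1 *s v" "y = a2 *s u + b2 *s v"
    using assms unfolding cspan2_def by blast
  then have "x + y = (a1 + a2) *s u + (b1 + b2) *s v"
    by (simp add: vec_eq_iff algebra_simps)
  then show ?thesis
    by (simp only: cspan2_lincomb)
qed

lemma cspan2_smult: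
  assumes "x \<in> cspan2 u v"
  shows "c *s x \<in> cspan2 u v"
proof -
  obtain a1 b1 where "x = a1 *s u + b1 *s v"
    using assms unfolding cspan2_def by blast
  then have "c *s x = (c * a1) *s u + (c * b1) *s v"
    by (simp add: vec_eq_iff algebra_simps)
  then show ?thesis
    by (simp only: cspan2_lincomb)
qed

lemma cspan2_subset:
  assumes "x \<in> cspan2 u v" "y \<in> cspan2 u v"
  shows "cspan2 x y \<subseteq> cspan2 u v"
proof
  fix z
  assume "z \<in> cspan2 x y"
  then obtain \<alpha> \<beta> where "z = \<alpha> *s x + \<beta> *s y"
    unfolding cspan2_def by blast
  then show "z \<in> cspan2 u v"
    using assms by (simp add: cspan2_add cspan2_smult)
qed

lemma cspan2_subset_of_indep:
  assumes ind: "indep p q" and p: "p \<in> cspan2 u v" and q: "q \<in> cspan2 u v"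
  shows "cspan2 u v \<subseteq> cspan2 p q"
proof
  obtain a1 b1 where p': "p = a1 *s u + b1 *s v"
    using p unfolding cspan2_def by blast
  obtain a2 b2 where q': "q = a2 *s u + b2 *s v"
    using q unfolding cspan2_def by blast
  have lincomb: "\<alpha> *s p + \<beta> *s q = (\<alpha> * a1 + \<beta> * a2) *s u + (\<alpha> * b1 + \<beta> * b2) *s v" for \<alpha> \<beta>
    unfolding p' q' by (simp add: vec_eq_iff algebra_simps)
  have D: "det2 a1 b1 a2 b2 \<noteq> 0"
  proof
    assume D: "det2 a1 b1 a2 b2 = 0"
    have "b2 *s p + (- b1) *s q = 0" "(- a2) *s p + a1 *s q = 0"
      unfolding lincomb using D by (simp_all add: det2_def algebra_simps)
    then have "a1 = 0" "a2 = 0" "b1 = 0" "b2 = 0"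
      using ind unfolding indep_def by (metis neg_equal_0_iff_equal)+
    then have "1 *s p + 0 *s q = 0"
      unfolding p' by simp
    then show False
      using ind unfolding indep_def by (metis zero_neq_one)
  qed
  fix x
  assume "x \<in> cspan2 u v"
  then obtain g h where x: "x = g *s u + h *s v"
    unfolding cspan2_def by blast
  define \<alpha> where "\<alpha> = det2 g h a2 b2 / det2 a1 b1 a2 b2"
  define \<beta> where "\<beta> = det2 a1 b1 g h / det2 a1 b1 a2 b2"
  have "g = \<alpha> * a1 + \<beta> * a2" "h = \<alpha> * b1 + \<beta> * b2"
    unfolding \<alpha>_def \<beta>_def by (fact cramer2[OF D])+
  then have "x = \<alpha> *s p + \<beta> *s q"
    unfolding lincomb x by simp
  then show "x \<in> cspan2 p q"
    by (simp only: cspan2_lincomb)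
qed

lemma cspan2_eq_of_indep:
  "indep p q \<Longrightarrow> p \<in> cspan2 u v \<Longrightarrow> q \<in> cspan2 u v \<Longrightarrow> cspan2 u v = cspan2 p q"
  by (simp add: cspan2_subset cspan2_subset_of_indep subset_antisym)

lemma indep_if_mem_notin:
  assumes p: "p \<in> cspan2 a b" "p \<noteq> 0" and q: "q \<notin> cspan2 a b"
  shows "indep p q"
  unfolding indep_def
proof (intro allI impI)
  fix \<alpha> \<beta>
  assume h: "\<alpha> *s p + \<beta> *s q = 0"
  have "\<beta> = 0"
  proof (rule ccontr)
    assume "\<beta> \<noteq> 0"
    have "\<beta> *s q = (- \<alpha>) *s p"
      using h by (simp add: vec_eq_iff eq_neg_iff_add_eq_0 add.commute)
    moreover have "q = (1 / \<beta>) *s (\<beta> *s q)"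
      using \<open>\<beta> \<noteq> 0\<close> by (simp add: vector_smult_assoc)
    ultimately have "q = (- \<alpha> / \<beta>) *s p"
      by (simp add: vector_smult_assoc)
    then show False
      using q p(1) cspan2_smult by metis
  qed
  then show "\<alpha> = 0 \<and> \<beta> = 0"
    using h p(2) by (auto simp: vec_eq_iff)
qed

lemma scaleR_eq_smult: "(r::real) *\<^sub>R (x::complex^4) = complex_of_real r *s x"
  by (simp only: vec_eq_iff vector_scaleR_component vector_smult_component)
    (simp add: scaleR_conv_of_real)

lemma closed_cspan2: "closed (cspan2 u v)"
proof (rule closed_subspace)
  show "subspace (cspan2 u v)"
    unfolding subspace_def by (simp add: scaleR_eq_smult cspan2_zero cspan2_add cspan2_smult)
qed

lemma closed_ann: "closed (ann L)"
proof (rule closed_subspace)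
  show "subspace (ann L)"
    unfolding subspace_def ann_def by (auto simp: scaleR_eq_smult)
qed

lemma meetsI: "z \<in> L \<Longrightarrow> z \<in> M \<Longrightarrow> z \<noteq> 0 \<Longrightarrow> meets L M"
  unfolding meets_def by blast

lemma line_meeting_cspan2_decomp:
  assumes L: "is_line L" and meets: "meets (cspan2 a b) L" and ne: "L \<noteq> cspan2 a b"
  shows "\<exists>p q. p \<in> cspan2 a b \<and> p \<noteq> 0 \<and> q \<notin> cspan2 a b \<and> L = cspan2 p q"
proof -
  obtain u v where uv: "indep u v" "L = cspan2 u v"
    using L by (auto simp: is_line_iff)
  have "\<not> L \<subseteq> cspan2 a b"
  proof
    assume "L \<subseteq> cspan2 a b"
    then have "cspan2 a b = L"
      using cspan2_eq_of_indep[OF uv(1)] cspan2_left cspan2_right uv(2) by blast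
    then show False
      using ne by simp
  qed
  then obtain q where q: "q \<in> L" "q \<notin> cspan2 a b"
    by blast
  obtain p where p: "p \<in> cspan2 a b" "p \<in> L" "p \<noteq> 0"
    using meets cspan2_zero uv(2) unfolding meets_def by blast
  have "L = cspan2 p q"
    using cspan2_eq_of_indep[OF indep_if_mem_notin[OF p(1,3) q(2)]] p(2) q(1) uv(2) by simp
  then show ?thesis
    using p q by blast
qed

lemma proper_transform_subset:
  assumes "closed L"
    and contains: "\<And>x w. x \<in> L \<Longrightarrow> x \<notin> l \<Longrightarrow> w \<in> ann l \<Longrightarrow> pairing w x = 0 \<Longrightarrow> w \<in> ann L"
    and "(x, w) \<in> proper_transform l L"
  shows "x \<in> L" "w \<in> ann L"
proof -
  have "{p \<in> blowup l. fst p \<in> L - l} \<subseteq> L \<times> ann L"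
    using contains unfolding blowup_def by auto
  moreover have "closed (L \<times> ann L)"
    using assms(1) closed_ann by (rule closed_Times)
  ultimately have "closure {p \<in> blowup l. fst p \<in> L - l} \<subseteq> L \<times> ann L"
    by (rule closure_minimal)
  then show "x \<in> L" "w \<in> ann L"
    using assms(3) unfolding proper_transform_def by auto
qed

section \<open>Bihomogeneous forms of bidegree (1,1)\<close>

definition biform :: "complex^4 \<Rightarrow> complex \<Rightarrow> complex \<Rightarrow> complex \<Rightarrow> complex \<Rightarrow> complex" where
  "biform n x y g h = n$1 * (x * g) + n$2 * (x * h) + n$3 * (y * g) + n$4 * (y * h)"

lemma biform_zero [simp]: "biform 0 x y g h = 0"
  by (simp add: biform_def)

lemma biform_lincomb:
  "biform (\<alpha> *s n - \<beta> *s n') x y g h = \<alpha> * biform n x y g h - \<beta> * biform n' x y g h"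
  by (simp add: biform_def algebra_simps)

lemma biform_scale: "biform n (k * x) (k * y) (\<kappa> * g) (\<kappa> * h) = k * \<kappa> * biform n x y g h"
  by (simp add: biform_def algebra_simps)

lemma biform_eq_0_iff: "(\<forall>x y g h. biform n x y g h = 0) \<longleftrightarrow> n = 0"
proof
  assume "\<forall>x y g h. biform n x y g h = 0"
  then have "biform n 1 0 1 0 = 0" "biform n 1 0 0 1 = 0" "biform n 0 1 1 0 = 0" "biform n 0 1 0 1 = 0"
    by blast+
  then show "n = 0"
    by (simp add: biform_def vec_eq_iff forall_4)
qed simp

text \<open>Lagrange interpolation in each factor of \<open>\<complex>\<^sup>2 \<times> \<complex>\<^sup>2\<close>.\<close>

lemma biform_interpolation:
  "det2 x2 y2 x3 y3 * det2 g2 h2 g3 h3 * biform n x y g h =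
     det2 x y x3 y3 * det2 g h g3 h3 * biform n x2 y2 g2 h2
   + det2 x y x3 y3 * det2 g2 h2 g h * biform n x2 y2 g3 h3
   + det2 x2 y2 x y * det2 g h g3 h3 * biform n x3 y3 g2 h2
   + det2 x2 y2 x y * det2 g2 h2 g h * biform n x3 y3 g3 h3"
  unfolding det2_def biform_def by algebra

definition pairwise_independent :: "('i \<Rightarrow> complex) \<Rightarrow> ('i \<Rightarrow> complex) \<Rightarrow> bool" where
  "pairwise_independent x y \<longleftrightarrow> (\<forall>r r'. r \<noteq> r' \<longrightarrow> det2 (x r) (y r) (x r') (y r') \<noteq> 0)"

lemma biform_eq_0_if_vanishes:
  assumes ijk: "distinct [i, j, k]"
    and indep: "pairwise_independent x y" "pairwise_independent g h"
    and zero: "biform n (x i) (y i) (g i) (h i) = 0" "biform n (x j) (y j) (g j) (h j) = 0"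
      "biform n (x k) (y k) (g k) (h k) = 0" "biform n (x j) (y j) (g k) (h k) = 0"
  shows "biform n X Y G H = 0"
proof -
  have interp: "det2 (x j) (y j) (x k) (y k) * det2 (g j) (h j) (g k) (h k) * biform n X' Y' G' H' =
      det2 X' Y' (x k) (y k) * det2 (g j) (h j) G' H' * biform n (x j) (y j) (g k) (h k)
    + det2 (x j) (y j) X' Y' * det2 G' H' (g k) (h k) * biform n (x k) (y k) (g j) (h j)" for X' Y' G' H'
    using biform_interpolation[of "x j" "y j" "x k" "y k" "g j" "h j" "g k" "h k" n X' Y' G' H'] zero(2,3)
    by simp
  \<comment> \<open>interpolating at the point \<open>i\<close> kills the other mixed value as well\<close>
  have "det2 (x j) (y j) (x i) (y i) * det2 (g i) (h i) (g k) (h k) * biform n (x k) (y k) (g j) (h j) = 0"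
    using interp[of "x i" "y i" "g i" "h i"] zero(1,4) by simp
  then have "biform n (x k) (y k) (g j) (h j) = 0"
    using indep ijk unfolding pairwise_independent_def by auto
  then show ?thesis
    using interp[of X Y G H] zero(4) indep ijk unfolding pairwise_independent_def by auto
qed

lemma biform_mixed_point_nonzero:
  assumes ijk: "distinct [i, j, k]"
    and indep: "pairwise_independent x y" "pairwise_independent g h"
    and "n \<noteq> 0" and zero: "\<forall>r\<in>{i, j, k}. biform n (x r) (y r) (g r) (h r) = 0"
  shows "biform n (x j) (y j) (g k) (h k) \<noteq> 0"
proof
  assume mixed: "biform n (x j) (y j) (g k) (h k) = 0"
  have "biform n X Y G H = 0" for X Y G H
    by (rule biform_eq_0_if_vanishes[OF ijk indep]) (use zero mixed in simp_all)
  then show False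
    using \<open>n \<noteq> 0\<close> biform_eq_0_iff by blast
qed

lemma biform_zero_sets_eq:
  assumes ijk: "distinct [i, j, k]"
    and indep: "pairwise_independent x y" "pairwise_independent g h"
    and nonzero: "n \<noteq> 0" "n' \<noteq> 0"
    and zero: "\<forall>r\<in>{i, j, k}. biform n (x r) (y r) (g r) (h r) = 0"
      "\<forall>r\<in>{i, j, k}. biform n' (x r) (y r) (g r) (h r) = 0"
  shows "biform n X Y G H = 0 \<longleftrightarrow> biform n' X Y G H = 0"
proof -
  define c where "c = biform n (x j) (y j) (g k) (h k)"
  define c' where "c' = biform n' (x j) (y j) (g k) (h k)"
  have "c \<noteq> 0" "c' \<noteq> 0"
    unfolding c_def c'_def using biform_mixed_point_nonzero[OF ijk indep] nonzero zero by simp_all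
  have "biform (c' *s n - c *s n') X Y G H = 0"
    by (rule biform_eq_0_if_vanishes[OF ijk indep]) (use zero in \<open>simp_all add: biform_lincomb c_def c'_def\<close>)
  then have scaled: "c' * biform n X Y G H = c * biform n' X Y G H"
    by (simp add: biform_lincomb)
  show ?thesis
  proof
    assume "biform n X Y G H = 0"
    then show "biform n' X Y G H = 0"
      using scaled \<open>c \<noteq> 0\<close> by simp
  next
    assume "biform n' X Y G H = 0"
    then show "biform n X Y G H = 0"
      using scaled \<open>c' \<noteq> 0\<close> by simp
  qed
qed

lemma biform_system_alternative:
  fixes x y g h R :: "4 \<Rightarrow> complex"
  shows "(\<exists>n. n \<noteq> 0 \<and> (\<forall>r. biform n (x r) (y r) (g r) (h r) = 0))
    \<or> (\<exists>n. \<forall>r. biform n (x r) (y r) (g r) (h r) = R r)"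
proof -
  define A :: "complex^4^4" where
    "A = (\<chi> r j. if j = 1 then x r * g r else if j = 2 then x r * h r else if j = 3 then y r * g r else y r * h r)"
  have A: "(A *v n) $ r = biform n (x r) (y r) (g r) (h r)" for n r
    unfolding A_def matrix_vector_mult_def biform_def by (simp add: sum_4 algebra_simps)
  show ?thesis
  proof (cases "\<exists>n. n \<noteq> 0 \<and> A *v n = 0")
    case True
    then show ?thesis
      using A by (metis zero_index)
  next
    case False
    then obtain n where "A *v n = (\<chi> r. R r)"
      using square_system_alternative[of A] by blast
    then show ?thesis
      using A by (metis vec_lambda_beta)
  qed
qed

section \<open>Coordinates adapted to a line\<close>

locale dual_frame =
  fixes a b c d ea eb ec ed :: "complex^4"
  assumes dual:
      "pairing ea a = 1" "pairing ea b = 0" "pairing ea c = 0" "pairing ea d = 0"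
      "pairing eb a = 0" "pairing eb b = 1" "pairing eb c = 0" "pairing eb d = 0"
      "pairing ec a = 0" "pairing ec b = 0" "pairing ec c = 1" "pairing ec d = 0"
      "pairing ed a = 0" "pairing ed b = 0" "pairing ed c = 0" "pairing ed d = 1"
    and expand: "\<And>z. z = pairing ea z *s a + pairing eb z *s b + pairing ec z *s c + pairing ed z *s d"

lemma indep_minor_nonzero:
  assumes ind: "indep a b"
  shows "\<exists>i j. a$i * b$j - a$j * b$i \<noteq> 0"
proof (rule ccontr)
  assume "\<not> ?thesis"
  then have minors: "\<And>i j. a$i * b$j = a$j * b$i"
    by auto
  show False
  proof (cases "a = 0")
    case True
    then have "1 *s a + 0 *s b = 0"
      by simp
    then show False
      using ind unfolding indep_def by (metis zero_neq_one)
  next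
    case False
    then obtain r where r: "a$r \<noteq> 0"
      by (auto simp: vec_eq_iff)
    have "(- b$r) *s a + (a$r) *s b = 0"
      by (auto simp: vec_eq_iff minors algebra_simps)
    then show False
      using ind r unfolding indep_def by blast
  qed
qed

text \<open>\<open>ea\<close> and \<open>eb\<close> invert the nonzero \<open>2 \<times> 2\<close> minor of \<open>a, b\<close>, the unit vectors
  \<open>c, d\<close> complete \<open>a, b\<close> to a basis, and \<open>ec, ed\<close> are the corresponding unit covectors
  corrected to vanish on \<open>a, b\<close>.\<close>

lemma dual_frame_of_minor:
  fixes a b :: "complex^4"
  assumes dist: "distinct [i, j, k, m]" and minor: "a$i * b$j - a$j * b$i \<noteq> 0"
  shows "\<exists>c d ea eb ec ed. dual_frame a b c d ea eb ec ed"
proof -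
  define D where "D = a$i * b$j - a$j * b$i"
  define ea :: "complex^4" where "ea = (\<chi> n. if n = i then b$j / D else if n = j then - b$i / D else 0)"
  define eb :: "complex^4" where "eb = (\<chi> n. if n = i then - a$j / D else if n = j then a$i / D else 0)"
  define c :: "complex^4" where "c = (\<chi> n. if n = k then 1 else 0)"
  define d :: "complex^4" where "d = (\<chi> n. if n = m then 1 else 0)"
  define ec :: "complex^4" where "ec = (\<chi> n. (if n = k then 1 else 0) - a$k * ea$n - b$k * eb$n)"
  define ed :: "complex^4" where "ed = (\<chi> n. (if n = m then 1 else 0) - a$m * ea$n - b$m * eb$n)"
  have D: "D \<noteq> 0"
    using minor D_def by simp
  have ne: "i \<noteq> j" "i \<noteq> k" "i \<noteq> m" "j \<noteq> k" "j \<noteq> m" "k \<noteq> m"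
    "j \<noteq> i" "k \<noteq> i" "m \<noteq> i" "k \<noteq> j" "m \<noteq> j" "m \<noteq> k"
    using dist by auto
  have P: "\<And>w z. pairing w z = w$i * z$i + w$j * z$j + w$k * z$k + w$m * z$m"
    unfolding pairing_def by (rule sum_UNIV_distinct4[OF dist])
  have "dual_frame a b c d ea eb ec ed"
  proof
    show "pairing ea a = 1" "pairing ea b = 0" "pairing ea c = 0" "pairing ea d = 0"
         "pairing eb a = 0" "pairing eb b = 1" "pairing eb c = 0" "pairing eb d = 0"
         "pairing ec a = 0" "pairing ec b = 0" "pairing ec c = 1" "pairing ec d = 0"
         "pairing ed a = 0" "pairing ed b = 0" "pairing ed c = 0" "pairing ed d = 1"
      unfolding P ea_def eb_def ec_def ed_def c_def d_def using ne D
      by (simp_all add: field_simps) (simp_all add: D_def algebra_simps)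
  next
    fix z :: "complex^4"
    show "z = pairing ea z *s a + pairing eb z *s b + pairing ec z *s c + pairing ed z *s d"
      unfolding vec_eq_iff
    proof
      fix n
      have "n \<in> {i, j, k, m}"
        using UNIV_eq_distinct4[OF dist] by auto
      then show "z$n = (pairing ea z *s a + pairing eb z *s b + pairing ec z *s c + pairing ed z *s d)$n"
        unfolding P ea_def eb_def ec_def ed_def c_def d_def using ne D
        by (auto simp: field_simps) (simp_all add: D_def algebra_simps)
    qed
  qed
  then show ?thesis
    by blast
qed

lemma dual_frame_exists:
  assumes "indep a b"
  shows "\<exists>c d ea eb ec ed. dual_frame a b c d ea eb ec ed"
proof -
  obtain i j where minor: "a$i * b$j - a$j * b$i \<noteq> 0"
    using indep_minor_nonzero[OF assms] by blast
  then have "i \<noteq> j"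
    by auto
  then obtain k m where "distinct [i, j, k, m]"
    using distinct4_extend by blast
  then show ?thesis
    using dual_frame_of_minor minor by blast
qed

context dual_frame
begin

lemma pairing_expand:
  "pairing w z = pairing w a * pairing ea z + pairing w b * pairing eb z
    + pairing w c * pairing ec z + pairing w d * pairing ed z"
  by (subst expand[of z]) (simp add: algebra_simps)

lemma covector_expand:
  "w = pairing w a *s ea + pairing w b *s eb + pairing w c *s ec + pairing w d *s ed"
proof (simp only: vec_eq_iff, rule allI)
  fix n
  have "w$n = pairing w (axis n 1)"
    by (simp add: pairing_axis)
  also have "\<dots> = pairing w a * ea$n + pairing w b * eb$n + pairing w c * ec$n + pairing w d * ed$n"
    by (subst pairing_expand) (simp add: pairing_axis)
  finally show "w$n = (pairing w a *s ea + pairing w b *s eb + pairing w c *s ec + pairing w d *s ed)$n"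
    by simp
qed

lemma coords_eqI:
  "pairing ea x = pairing ea y \<Longrightarrow> pairing eb x = pairing eb y \<Longrightarrow>
    pairing ec x = pairing ec y \<Longrightarrow> pairing ed x = pairing ed y \<Longrightarrow> x = y"
  by (metis expand)

lemma mem_line_iff: "z \<in> cspan2 a b \<longleftrightarrow> pairing ec z = 0 \<and> pairing ed z = 0"
proof
  assume "z \<in> cspan2 a b"
  then show "pairing ec z = 0 \<and> pairing ed z = 0"
    unfolding cspan2_def by (auto simp: dual)
next
  assume "pairing ec z = 0 \<and> pairing ed z = 0"
  then have "z = pairing ea z *s a + pairing eb z *s b"
    using expand[of z] by simp
  then show "z \<in> cspan2 a b"
    by (metis cspan2_lincomb)
qed

lemma line_point_expand: "z \<in> cspan2 a b \<Longrightarrow> z = pairing ea z *s a + pairing eb z *s b"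
  using expand[of z] by (simp add: mem_line_iff)

lemma mem_ann_line_iff: "w \<in> ann (cspan2 a b) \<longleftrightarrow> pairing w a = 0 \<and> pairing w b = 0"
proof
  assume "w \<in> ann (cspan2 a b)"
  then show "pairing w a = 0 \<and> pairing w b = 0"
    unfolding ann_def using cspan2_left cspan2_right by blast
next
  assume "pairing w a = 0 \<and> pairing w b = 0"
  then show "w \<in> ann (cspan2 a b)"
    unfolding ann_def cspan2_def by auto
qed

lemma ann_line_pairing:
  "w \<in> ann (cspan2 a b) \<Longrightarrow> pairing w z = pairing w c * pairing ec z + pairing w d * pairing ed z"
  using pairing_expand[of w z] by (simp add: mem_ann_line_iff)

lemma off_line_coords: "q \<notin> cspan2 a b \<Longrightarrow> pairing ec q \<noteq> 0 \<or> pairing ed q \<noteq> 0"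
  by (simp add: mem_line_iff)

lemma line_point_coords_nonzero:
  assumes "x \<in> cspan2 a b" "x \<noteq> 0"
  shows "pairing ea x \<noteq> 0 \<or> pairing eb x \<noteq> 0"
  using line_point_expand[OF assms(1)] assms(2) by auto

lemma line_points_proportional:
  assumes "x \<in> cspan2 a b" "x \<noteq> 0" "y \<in> cspan2 a b"
    and "det2 (pairing ea x) (pairing eb x) (pairing ea y) (pairing eb y) = 0"
  shows "\<exists>k. y = k *s x"
proof -
  obtain k where "pairing ea y = k * pairing ea x" "pairing eb y = k * pairing eb x"
    using det2_eq_0_proportional line_point_coords_nonzero[OF assms(1,2)] assms(4) by blast
  then have "y = k *s x"
    using assms(1,3) by (intro coords_eqI) (simp_all add: mem_line_iff)
  then show ?thesis
    by blast
qed

lemma line_spanned_by_points: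
  assumes x: "x \<in> cspan2 a b" and y: "y \<in> cspan2 a b" and z: "z \<in> cspan2 a b"
    and xy: "det2 (pairing ea x) (pairing eb x) (pairing ea y) (pairing eb y) \<noteq> 0"
  shows "\<exists>\<alpha> \<beta>. z = \<alpha> *s x + \<beta> *s y"
proof -
  let ?D = "det2 (pairing ea x) (pairing eb x) (pairing ea y) (pairing eb y)"
  define \<alpha> where "\<alpha> = det2 (pairing ea z) (pairing eb z) (pairing ea y) (pairing eb y) / ?D"
  define \<beta> where "\<beta> = det2 (pairing ea x) (pairing eb x) (pairing ea z) (pairing eb z) / ?D"
  have "z = \<alpha> *s x + \<beta> *s y"
  proof (rule coords_eqI)
    show "pairing ea z = pairing ea (\<alpha> *s x + \<beta> *s y)" "pairing eb z = pairing eb (\<alpha> *s x + \<beta> *s y)"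
      using cramer2[OF xy] unfolding \<alpha>_def \<beta>_def by simp_all
    show "pairing ec z = pairing ec (\<alpha> *s x + \<beta> *s y)" "pairing ed z = pairing ed (\<alpha> *s x + \<beta> *s y)"
      using x y z by (simp_all add: mem_line_iff)
  qed
  then show ?thesis
    by blast
qed

lemma lincomb_mem_line_iff:
  assumes "p \<in> cspan2 a b" "q \<notin> cspan2 a b" "x = \<alpha> *s p + \<beta> *s q"
  shows "x \<in> cspan2 a b \<longleftrightarrow> \<beta> = 0"
proof -
  have "pairing ec p = 0" "pairing ed p = 0"
    using assms(1) mem_line_iff by simp_all
  then have "pairing ec x = \<beta> * pairing ec q" "pairing ed x = \<beta> * pairing ed q"
    using assms(3) by simp_all
  then show ?thesis
    using off_line_coords[OF assms(2)] mem_line_iff[of x] by auto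
qed

lemma cspan2_inter_line:
  assumes "p \<in> cspan2 a b" "q \<notin> cspan2 a b" "x \<in> cspan2 p q" "x \<in> cspan2 a b"
  shows "\<exists>k. x = k *s p"
proof -
  obtain \<alpha> \<beta> where x: "x = \<alpha> *s p + \<beta> *s q"
    using assms(3) unfolding cspan2_def by blast
  then have "\<beta> = 0"
    using lincomb_mem_line_iff assms(1,2,4) by blast
  then show ?thesis
    using x by auto
qed

definition join_plane :: "complex^4 \<Rightarrow> complex^4" where
  "join_plane q = pairing ed q *s ec - pairing ec q *s ed"

lemma join_plane_coords [simp]:
  "pairing (join_plane q) c = pairing ed q" "pairing (join_plane q) d = - pairing ec q"
  by (simp_all add: join_plane_def dual)

lemma join_plane_mem_ann_line: "join_plane q \<in> ann (cspan2 a b)"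
  by (simp add: mem_ann_line_iff join_plane_def dual)

lemma join_plane_self: "pairing (join_plane q) q = 0"
  by (simp add: join_plane_def algebra_simps)

lemma join_plane_nonzero:
  assumes "q \<notin> cspan2 a b"
  shows "join_plane q \<noteq> 0"
proof
  assume "join_plane q = 0"
  then have "pairing ec q = 0" "pairing ed q = 0"
    using join_plane_coords[of q] by simp_all
  then show False
    using off_line_coords[OF assms] by simp
qed

lemma join_plane_mem_ann:
  assumes "p \<in> cspan2 a b"
  shows "join_plane q \<in> ann (cspan2 p q)"
proof -
  have "pairing (join_plane q) p = 0"
    using join_plane_mem_ann_line assms unfolding ann_def by blast
  then show ?thesis
    unfolding ann_def cspan2_def by (auto simp: join_plane_self)
qed

lemma ann_line_through_point:
  assumes w: "w \<in> ann (cspan2 a b)" "pairing w q = 0" and q: "q \<notin> cspan2 a b"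
  shows "\<exists>\<kappa>. w = \<kappa> *s join_plane q"
proof -
  have wq: "pairing w c * pairing ec q + pairing w d * pairing ed q = 0"
    using ann_line_pairing[OF w(1), of q] w(2) by simp
  obtain \<kappa> where \<kappa>: "pairing w c = \<kappa> * pairing ed q" "pairing w d = - \<kappa> * pairing ec q"
  proof (cases "pairing ec q = 0")
    case True
    then have "pairing ed q \<noteq> 0"
      using off_line_coords[OF q] by simp
    then show ?thesis
      using True wq by (intro that[of "pairing w c / pairing ed q"]) (simp_all add: field_simps)
  next
    case False
    have "pairing w c * pairing ec q = - (pairing w d * pairing ed q)"
      using wq by (simp add: eq_neg_iff_add_eq_0)
    then show ?thesis
      using False by (intro that[of "- pairing w d / pairing ec q"]) (simp_all add: field_simps)
  qed
  have "w = pairing w c *s ec + pairing w d *s ed"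
    using covector_expand[of w] w(1) by (simp add: mem_ann_line_iff)
  also have "\<dots> = \<kappa> *s join_plane q"
    unfolding \<kappa> join_plane_def by (simp add: vec_eq_iff algebra_simps)
  finally show ?thesis
    by blast
qed

lemma ann_line_contains_cspan2:
  assumes p: "p \<in> cspan2 a b" and q: "q \<notin> cspan2 a b"
    and x: "x \<in> cspan2 p q" "x \<notin> cspan2 a b"
    and w: "w \<in> ann (cspan2 a b)" "pairing w x = 0"
  shows "w \<in> ann (cspan2 p q)"
proof -
  obtain \<alpha> \<beta> where x': "x = \<alpha> *s p + \<beta> *s q"
    using x(1) unfolding cspan2_def by blast
  have "\<beta> \<noteq> 0"
    using lincomb_mem_line_iff[OF p q x'] x(2) by blast
  have "pairing w p = 0"
    using w(1) p unfolding ann_def by blast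
  then have "pairing w q = 0"
    using w(2) \<open>\<beta> \<noteq> 0\<close> unfolding x' by simp
  then show ?thesis
    using \<open>pairing w p = 0\<close> unfolding ann_def cspan2_def by auto
qed

lemma mem_proper_transform:
  assumes p: "p \<in> cspan2 a b" "p \<noteq> 0" and q: "q \<notin> cspan2 a b"
    and W: "W \<in> ann (cspan2 a b)" "W \<in> ann (cspan2 p q)" "W \<noteq> 0"
  shows "(p, W) \<in> proper_transform (cspan2 a b) (cspan2 p q)"
proof -
  define f where "f n = (1 *s p + complex_of_real (1 / real (Suc n)) *s q, W)" for n
  have "f n \<in> {z \<in> blowup (cspan2 a b). fst z \<in> cspan2 p q - cspan2 a b}" for n
  proof -
    have on: "fst (f n) \<in> cspan2 p q"
      unfolding f_def fst_conv by (rule cspan2_lincomb)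
    have "complex_of_real (1 / real (Suc n)) \<noteq> 0"
      unfolding of_real_eq_0_iff by simp
    then have off: "fst (f n) \<notin> cspan2 a b"
      unfolding f_def fst_conv lincomb_mem_line_iff[OF p(1) q refl] .
    then have "fst (f n) \<noteq> 0"
      using cspan2_zero[of a b] by auto
    moreover have "pairing W (fst (f n)) = 0"
      using W(2) on unfolding ann_def by blast
    ultimately show ?thesis
      using on off W unfolding blowup_def f_def by auto
  qed
  moreover have "f \<longlonglongrightarrow> (p, W)"
  proof -
    have "(\<lambda>n. inverse (real (Suc n)) *\<^sub>R q) \<longlonglongrightarrow> 0 *\<^sub>R q"
      by (intro tendsto_scaleR tendsto_const LIMSEQ_inverse_real_of_nat)
    then have "(\<lambda>n. p + (1 / real (Suc n)) *\<^sub>R q) \<longlonglongrightarrow> p"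
      using tendsto_add[OF tendsto_const, of _ 0 sequentially p] by (simp add: divide_inverse)
    moreover have "f = (\<lambda>n. (p + (1 / real (Suc n)) *\<^sub>R q, W))"
      unfolding f_def by (simp add: scaleR_eq_smult)
    ultimately show ?thesis
      by (simp only:) (intro tendsto_Pair tendsto_const)
  qed
  ultimately have "(p, W) \<in> closure {z \<in> blowup (cspan2 a b). fst z \<in> cspan2 p q - cspan2 a b}"
    unfolding closure_sequential by blast
  moreover have "(p, W) \<in> blowup (cspan2 a b)"
    using p W unfolding blowup_def ann_def by auto
  ultimately show ?thesis
    unfolding proper_transform_def by blast
qed

lemma proper_transform_exc_div:
  assumes p: "p \<in> cspan2 a b" "p \<noteq> 0" and q: "q \<notin> cspan2 a b"
    and xw: "(x, w) \<in> exc_div (cspan2 a b)" "(x, w) \<in> proper_transform (cspan2 a b) (cspan2 p q)"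
  shows "\<exists>k \<kappa>. k \<noteq> 0 \<and> \<kappa> \<noteq> 0 \<and> x = k *s p \<and> w = \<kappa> *s join_plane q"
proof -
  have E: "x \<in> cspan2 a b" "x \<noteq> 0" "w \<in> ann (cspan2 a b)" "w \<noteq> 0"
    using xw(1) unfolding exc_div_def blowup_def by auto
  have L: "x \<in> cspan2 p q" "w \<in> ann (cspan2 p q)"
    using proper_transform_subset[OF closed_cspan2 ann_line_contains_cspan2[OF p(1) q] xw(2)] by auto
  obtain k where k: "x = k *s p"
    using cspan2_inter_line[OF p(1) q L(1) E(1)] by blast
  have "pairing w q = 0"
    using L(2) cspan2_right unfolding ann_def by blast
  then obtain \<kappa> where \<kappa>: "w = \<kappa> *s join_plane q"
    using ann_line_through_point E(3) q by blast
  show ?thesis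
    using k \<kappa> E(2,4) by (intro exI[of _ k] exI[of _ \<kappa>]) auto
qed

lemma join_point_mem:
  assumes p: "p \<in> cspan2 a b" "p \<noteq> 0" and q: "q \<notin> cspan2 a b"
  shows "(p, join_plane q) \<in> exc_div (cspan2 a b)"
    and "(p, join_plane q) \<in> proper_transform (cspan2 a b) (cspan2 p q)"
proof -
  have "pairing (join_plane q) p = 0"
    using join_plane_mem_ann_line p(1) unfolding ann_def by blast
  then show "(p, join_plane q) \<in> exc_div (cspan2 a b)"
    unfolding exc_div_def blowup_def using p join_plane_mem_ann_line join_plane_nonzero[OF q] by auto
  show "(p, join_plane q) \<in> proper_transform (cspan2 a b) (cspan2 p q)"
    using mem_proper_transform[OF p q join_plane_mem_ann_line join_plane_mem_ann[OF p(1)] join_plane_nonzero[OF q]] .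
qed

text \<open>On the exceptional divisor, a point \<open>x\<close> of the line gets coordinates \<open>(ea x, eb x)\<close>
  and a plane \<open>w\<close> through it gets \<open>(- w d, w c)\<close>, so that \<open>join_plane q\<close> has
  coordinates \<open>(ec q, ed q)\<close>.\<close>

definition curve_eq :: "complex^4 \<Rightarrow> complex^4 \<Rightarrow> complex^4 \<Rightarrow> complex" where
  "curve_eq n x w = biform n (pairing ea x) (pairing eb x) (- pairing w d) (pairing w c)"

definition zero_curve :: "complex^4 \<Rightarrow> ((complex^4) \<times> (complex^4)) set" where
  "zero_curve n = {(x, w) \<in> exc_div (cspan2 a b). curve_eq n x w = 0}"

definition form_coeffs :: "complex^4^4 \<Rightarrow> complex^4" where
  "form_coeffs M = (\<chi> j. if j = 1 then - pairing ed (M *v a) else if j = 2 then pairing ec (M *v a)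
     else if j = 3 then - pairing ed (M *v b) else pairing ec (M *v b))"

lemma pairing_matrix_eq_curve_eq:
  assumes x: "x \<in> cspan2 a b" and w: "w \<in> ann (cspan2 a b)"
  shows "pairing w (M *v x) = curve_eq (form_coeffs M) x w"
proof -
  have "M *v x = M *v (pairing ea x *s a + pairing eb x *s b)"
    by (rule arg_cong[OF line_point_expand[OF x]])
  also have "\<dots> = pairing ea x *s (M *v a) + pairing eb x *s (M *v b)"
    by (simp add: matrix_vector_right_distrib matrix_vector_mult_smult)
  finally have "pairing w (M *v x) = pairing ea x * pairing w (M *v a) + pairing eb x * pairing w (M *v b)"
    by simp
  then show ?thesis
    unfolding ann_line_pairing[OF w, of "M *v a"] ann_line_pairing[OF w, of "M *v b"]
    by (simp add: curve_eq_def biform_def form_coeffs_def algebra_simps)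
qed

lemma form_coeffs_surj: "\<exists>M. form_coeffs M = n"
proof -
  define M :: "complex^4^4" where
    "M = (\<chi> i j. (n$2 * ea$j + n$4 * eb$j) * c$i - (n$1 * ea$j + n$3 * eb$j) * d$i)"
  have Mv: "M *v y = (n$2 * pairing ea y + n$4 * pairing eb y) *s c - (n$1 * pairing ea y + n$3 * pairing eb y) *s d" for y
    unfolding M_def matrix_vector_mult_def pairing_def
    by (simp add: vec_eq_iff algebra_simps sum.distrib sum_subtractf sum_distrib_left)
  have "form_coeffs M = n"
    by (simp add: form_coeffs_def Mv dual vec_eq_iff forall_4)
  then show ?thesis
    by blast
qed

lemma curve11_iff: "curve11 (cspan2 a b) C \<longleftrightarrow> (\<exists>n. n \<noteq> 0 \<and> C = zero_curve n)"
proof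
  assume "curve11 (cspan2 a b) C"
  then obtain M where M: "\<exists>x\<in>cspan2 a b. \<exists>w\<in>ann (cspan2 a b). pairing w (M *v x) \<noteq> 0"
    "C = {(x, w) \<in> exc_div (cspan2 a b). pairing w (M *v x) = 0}"
    unfolding curve11_def by blast
  have "form_coeffs M \<noteq> 0"
    using M(1) pairing_matrix_eq_curve_eq by (force simp: curve_eq_def)
  moreover have "C = zero_curve (form_coeffs M)"
    unfolding M(2) zero_curve_def exc_div_def blowup_def using pairing_matrix_eq_curve_eq by auto
  ultimately show "\<exists>n. n \<noteq> 0 \<and> C = zero_curve n"
    by blast
next
  assume "\<exists>n. n \<noteq> 0 \<and> C = zero_curve n"
  then obtain n where n: "n \<noteq> 0" "C = zero_curve n"
    by blast
  obtain M where M: "form_coeffs M = n"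
    using form_coeffs_surj by blast
  obtain X Y G H where XYGH: "biform n X Y G H \<noteq> 0"
    using n(1) biform_eq_0_iff by blast
  define x where "x = X *s a + Y *s b"
  define w where "w = H *s ec - G *s ed"
  have xw: "x \<in> cspan2 a b" "w \<in> ann (cspan2 a b)"
    unfolding x_def w_def by (simp_all add: cspan2_lincomb mem_ann_line_iff dual)
  have "curve_eq n x w = biform n X Y G H"
    unfolding curve_eq_def x_def w_def by (simp add: dual)
  then have "pairing w (M *v x) \<noteq> 0"
    using pairing_matrix_eq_curve_eq[OF xw] M XYGH by simp
  moreover have "C = {(x, w) \<in> exc_div (cspan2 a b). pairing w (M *v x) = 0}"
    unfolding n(2) zero_curve_def exc_div_def blowup_def using pairing_matrix_eq_curve_eq M by auto
  ultimately show "curve11 (cspan2 a b) C"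
    unfolding curve11_def using xw by blast
qed

lemma zero_curve_meets_iff:
  assumes p: "p \<in> cspan2 a b" "p \<noteq> 0" and q: "q \<notin> cspan2 a b"
  shows "zero_curve n \<inter> proper_transform (cspan2 a b) (cspan2 p q) \<noteq> {} \<longleftrightarrow>
    biform n (pairing ea p) (pairing eb p) (pairing ec q) (pairing ed q) = 0"
    (is "_ \<longleftrightarrow> ?B = 0")
proof
  assume "zero_curve n \<inter> proper_transform (cspan2 a b) (cspan2 p q) \<noteq> {}"
  then obtain x w where xw: "(x, w) \<in> exc_div (cspan2 a b)" "curve_eq n x w = 0"
    "(x, w) \<in> proper_transform (cspan2 a b) (cspan2 p q)"
    unfolding zero_curve_def by blast
  then obtain k \<kappa> where k\<kappa>: "k \<noteq> 0" "\<kappa> \<noteq> 0" "x = k *s p" "w = \<kappa> *s join_plane q"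
    using proper_transform_exc_div[OF p q] by blast
  have "curve_eq n x w = k * \<kappa> * ?B"
    unfolding k\<kappa>(3,4) curve_eq_def using biform_scale[of n k _ _ \<kappa>] by simp
  then show "?B = 0"
    using xw(2) k\<kappa>(1,2) by simp
next
  assume "?B = 0"
  then have "(p, join_plane q) \<in> zero_curve n"
    using join_point_mem(1)[OF p q] by (simp add: zero_curve_def curve_eq_def)
  then show "zero_curve n \<inter> proper_transform (cspan2 a b) (cspan2 p q) \<noteq> {}"
    using join_point_mem(2)[OF p q] by blast
qed

text \<open>The graph of a linear map \<open>cspan2 c d \<rightarrow> cspan2 a b\<close>, with signs chosen so that the
  linear part of the condition in \<open>graph_line_meets\<close> is the form \<open>n\<close>.\<close>

definition graph_line :: "complex^4 \<Rightarrow> (complex^4) set" where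
  "graph_line n = cspan2 (n$3 *s a - n$1 *s b + c) (n$4 *s a - n$2 *s b + d)"

lemma is_line_graph_line: "is_line (graph_line n)"
  unfolding is_line_iff graph_line_def indep_def
proof (intro exI conjI allI impI)
  fix \<alpha> \<beta>
  assume h: "\<alpha> *s (n$3 *s a - n$1 *s b + c) + \<beta> *s (n$4 *s a - n$2 *s b + d) = 0"
  show "\<alpha> = 0" "\<beta> = 0"
    using arg_cong[OF h, of "pairing ec"] arg_cong[OF h, of "pairing ed"] by (simp_all add: dual)
qed simp

lemma graph_line_ne_line: "graph_line n \<noteq> cspan2 a b"
proof
  assume "graph_line n = cspan2 a b"
  then have "n$3 *s a - n$1 *s b + c \<in> cspan2 a b"
    unfolding graph_line_def using cspan2_left by metis
  then show False
    by (simp add: mem_line_iff dual)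
qed

lemma graph_line_meets:
  assumes p: "p \<in> cspan2 a b" "p \<noteq> 0" and q: "q \<notin> cspan2 a b"
    and eq: "biform n (pairing ea p) (pairing eb p) (pairing ec q) (pairing ed q) =
      det2 (pairing ea q) (pairing eb q) (pairing ea p) (pairing eb p)"
  shows "meets (graph_line n) (cspan2 p q)"
proof -
  define z where "z = pairing ec q *s (n$3 *s a - n$1 *s b + c) + pairing ed q *s (n$4 *s a - n$2 *s b + d)"
  have z: "pairing ea z = pairing ec q * n$3 + pairing ed q * n$4"
    "pairing eb z = - pairing ec q * n$1 - pairing ed q * n$2"
    "pairing ec z = pairing ec q" "pairing ed z = pairing ed q"
    unfolding z_def by (simp_all add: dual)
  have "det2 (pairing ea p) (pairing eb p) (pairing ea z - pairing ea q) (pairing eb z - pairing eb q) = 0"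
    using eq unfolding z by (simp add: det2_def biform_def algebra_simps)
  then obtain k where k: "pairing ea z - pairing ea q = k * pairing ea p"
    "pairing eb z - pairing eb q = k * pairing eb p"
    using det2_eq_0_proportional line_point_coords_nonzero[OF p] by blast
  have "z = k *s p + 1 *s q"
  proof (rule coords_eqI)
    show "pairing ea z = pairing ea (k *s p + 1 *s q)" "pairing eb z = pairing eb (k *s p + 1 *s q)"
      using k by (simp_all add: algebra_simps)
    show "pairing ec z = pairing ec (k *s p + 1 *s q)" "pairing ed z = pairing ed (k *s p + 1 *s q)"
      using p(1) z by (simp_all add: mem_line_iff)
  qed
  then have "z \<in> cspan2 p q"
    by (simp only: cspan2_lincomb)
  moreover have "z \<in> graph_line n"
    unfolding graph_line_def z_def by (rule cspan2_lincomb)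
  moreover have "z \<noteq> 0"
    using z(3,4) off_line_coords[OF q] by auto
  ultimately show ?thesis
    by (intro meetsI)
qed

end

section \<open>Four skew lines and their transversal\<close>

lemma skew_lines_meeting_cspan2_decomp:
  fixes L :: "4 \<Rightarrow> (complex^4) set"
  assumes lines: "\<And>r. is_line (L r)" and meets: "\<And>r. meets (cspan2 a b) (L r)"
    and skew: "\<And>r r'. r \<noteq> r' \<Longrightarrow> \<not> meets (L r) (L r')"
  shows "\<exists>p q. \<forall>r. p r \<in> cspan2 a b \<and> p r \<noteq> 0 \<and> q r \<notin> cspan2 a b \<and> L r = cspan2 (p r) (q r)"
proof -
  have "\<exists>pq. fst pq \<in> cspan2 a b \<and> fst pq \<noteq> 0 \<and> snd pq \<notin> cspan2 a b \<and> L r = cspan2 (fst pq) (snd pq)" for r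
  proof -
    have "L r \<noteq> cspan2 a b"
    proof
      assume "L r = cspan2 a b"
      then have "meets (L r) (L (if r = 0 then 1 else 0))"
        using meets by simp
      then show False
        using skew[of r "if r = 0 then 1 else 0"] by simp
    qed
    then obtain p q where "p \<in> cspan2 a b" "p \<noteq> 0" "q \<notin> cspan2 a b" "L r = cspan2 p q"
      using line_meeting_cspan2_decomp[OF lines meets] by blast
    then show ?thesis
      by (intro exI[of _ "(p, q)"]) simp
  qed
  then obtain f where "\<forall>r. fst (f r) \<in> cspan2 a b \<and> fst (f r) \<noteq> 0 \<and> snd (f r) \<notin> cspan2 a b
      \<and> L r = cspan2 (fst (f r)) (snd (f r))"
    using choice[of "\<lambda>r pq. fst pq \<in> cspan2 a b \<and> fst pq \<noteq> 0 \<and> snd pq \<notin> cspan2 a b \<and> L r = cspan2 (fst pq) (snd pq)"]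
    by blast
  then show ?thesis
    by (intro exI[of _ "fst \<circ> f"] exI[of _ "snd \<circ> f"]) simp
qed

locale four_transversals = dual_frame +
  fixes p q :: "4 \<Rightarrow> complex^4"
  assumes p_on_line: "p r \<in> cspan2 a b" and p_nonzero: "p r \<noteq> 0"
    and q_off_line: "q r \<notin> cspan2 a b"
    and skew: "r \<noteq> r' \<Longrightarrow> \<not> meets (cspan2 (p r) (q r)) (cspan2 (p r') (q r'))"
begin

text \<open>The coordinates of the point where the proper transform of the \<open>r\<close>-th line meets the
  exceptional divisor.\<close>

abbreviation s :: "4 \<Rightarrow> complex" where "s r \<equiv> pairing ea (p r)"
abbreviation t :: "4 \<Rightarrow> complex" where "t r \<equiv> pairing eb (p r)"
abbreviation \<sigma> :: "4 \<Rightarrow> complex" where "\<sigma> r \<equiv> pairing ec (q r)"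
abbreviation \<tau> :: "4 \<Rightarrow> complex" where "\<tau> r \<equiv> pairing ed (q r)"

lemma points_pairwise_independent: "pairwise_independent s t"
  unfolding pairwise_independent_def
proof (intro allI impI notI)
  fix r r' :: 4
  assume "r \<noteq> r'" "det2 (s r) (t r) (s r') (t r') = 0"
  then obtain k where "p r' = k *s p r"
    using line_points_proportional[OF p_on_line p_nonzero p_on_line] by blast
  then have "p r' \<in> cspan2 (p r) (q r)"
    using cspan2_smult[OF cspan2_left] by metis
  then have "meets (cspan2 (p r) (q r)) (cspan2 (p r') (q r'))"
    using cspan2_left p_nonzero by (intro meetsI)
  then show False
    using skew \<open>r \<noteq> r'\<close> by blast
qed

text \<open>Two of the lines lying in a common plane through \<open>cspan2 a b\<close> would meet.\<close>

lemma planes_pairwise_independent: "pairwise_independent \<sigma> \<tau>"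
  unfolding pairwise_independent_def
proof (intro allI impI notI)
  fix r r' :: 4
  assume "r \<noteq> r'" "det2 (\<sigma> r) (\<tau> r) (\<sigma> r') (\<tau> r') = 0"
  then obtain k where k: "\<sigma> r' = k * \<sigma> r" "\<tau> r' = k * \<tau> r"
    using det2_eq_0_proportional off_line_coords[OF q_off_line] by blast
  have "q r' - k *s q r \<in> cspan2 a b"
    using k by (simp add: mem_line_iff)
  moreover have "det2 (s r) (t r) (s r') (t r') \<noteq> 0"
    using points_pairwise_independent \<open>r \<noteq> r'\<close> unfolding pairwise_independent_def by blast
  ultimately obtain \<alpha> \<beta> where \<alpha>\<beta>: "q r' - k *s q r = \<alpha> *s p r + \<beta> *s p r'"
    using line_spanned_by_points[OF p_on_line p_on_line] by blast
  have qr': "q r' = \<alpha> *s p r + \<beta> *s p r' + k *s q r"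
    using \<alpha>\<beta> by (simp add: diff_eq_eq)
  define v where "v = (- \<beta>) *s p r' + 1 *s q r'"
  have "v = \<alpha> *s p r + k *s q r"
    unfolding v_def by (subst qr') (simp add: vec_eq_iff algebra_simps)
  then have "v \<in> cspan2 (p r) (q r)"
    by (simp only: cspan2_lincomb)
  moreover have "v \<in> cspan2 (p r') (q r')"
    unfolding v_def by (rule cspan2_lincomb)
  moreover have "v \<noteq> 0"
  proof
    assume "v = 0"
    then have "pairing ec (q r') = 0" "pairing ed (q r') = 0"
      using p_on_line[of r'] unfolding v_def by (simp_all add: mem_line_iff)
    then show False
      using off_line_coords[OF q_off_line] by blast
  qed
  ultimately show False
    using skew \<open>r \<noteq> r'\<close> by (blast intro: meetsI)
qed

lemma zero_curves_eq:
  assumes "n \<noteq> 0" "n' \<noteq> 0"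
    and "\<forall>r. biform n (s r) (t r) (\<sigma> r) (\<tau> r) = 0" "\<forall>r. biform n' (s r) (t r) (\<sigma> r) (\<tau> r) = 0"
  shows "zero_curve n = zero_curve n'"
proof -
  have "distinct [1, 2, 3 :: 4]"
    by simp
  moreover have "\<forall>r\<in>{1, 2, 3}. biform n (s r) (t r) (\<sigma> r) (\<tau> r) = 0"
    "\<forall>r\<in>{1, 2, 3}. biform n' (s r) (t r) (\<sigma> r) (\<tau> r) = 0"
    using assms(3,4) by simp_all
  ultimately have "biform n X Y G H = 0 \<longleftrightarrow> biform n' X Y G H = 0" for X Y G H
    by (rule biform_zero_sets_eq[OF _ points_pairwise_independent planes_pairwise_independent assms(1,2)])
  then show ?thesis
    unfolding zero_curve_def curve_eq_def by (simp only:)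
qed

lemma exists_vanishing_form:
  assumes unique: "\<And>L. is_line L \<Longrightarrow> \<forall>r. meets L (cspan2 (p r) (q r)) \<Longrightarrow> L = cspan2 a b"
  shows "\<exists>n. n \<noteq> 0 \<and> (\<forall>r. biform n (s r) (t r) (\<sigma> r) (\<tau> r) = 0)"
  using biform_system_alternative[of s t \<sigma> \<tau> "\<lambda>r. det2 (pairing ea (q r)) (pairing eb (q r)) (s r) (t r)"]
proof
  assume "\<exists>n. n \<noteq> 0 \<and> (\<forall>r. biform n (s r) (t r) (\<sigma> r) (\<tau> r) = 0)"
  then show ?thesis .
next
  assume "\<exists>n. \<forall>r. biform n (s r) (t r) (\<sigma> r) (\<tau> r) = det2 (pairing ea (q r)) (pairing eb (q r)) (s r) (t r)"
  then obtain n where "biform n (s r) (t r) (\<sigma> r) (\<tau> r) = det2 (pairing ea (q r)) (pairing eb (q r)) (s r) (t r)" for r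
    by blast
  then have "meets (graph_line n) (cspan2 (p r) (q r))" for r
    by (rule graph_line_meets[OF p_on_line p_nonzero q_off_line])
  then have "graph_line n = cspan2 a b"
    using unique[OF is_line_graph_line] by blast
  then show ?thesis
    using graph_line_ne_line by blast
qed

theorem unique_curve:
  assumes unique: "\<And>L. is_line L \<Longrightarrow> \<forall>r. meets L (cspan2 (p r) (q r)) \<Longrightarrow> L = cspan2 a b"
  shows "\<exists>!C. curve11 (cspan2 a b) C \<and> (\<forall>r. C \<inter> proper_transform (cspan2 a b) (cspan2 (p r) (q r)) \<noteq> {})"
proof -
  have meets_iff: "zero_curve n \<inter> proper_transform (cspan2 a b) (cspan2 (p r) (q r)) \<noteq> {} \<longleftrightarrow>
      biform n (s r) (t r) (\<sigma> r) (\<tau> r) = 0" for n r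
    by (rule zero_curve_meets_iff[OF p_on_line p_nonzero q_off_line])
  obtain n where n: "n \<noteq> 0" "\<forall>r. biform n (s r) (t r) (\<sigma> r) (\<tau> r) = 0"
    using exists_vanishing_form[OF unique] by blast
  show ?thesis
  proof (rule ex1I[of _ "zero_curve n"])
    show "curve11 (cspan2 a b) (zero_curve n) \<and>
        (\<forall>r. zero_curve n \<inter> proper_transform (cspan2 a b) (cspan2 (p r) (q r)) \<noteq> {})"
      using n by (auto simp: curve11_iff meets_iff)
  next
    fix C
    assume C: "curve11 (cspan2 a b) C \<and> (\<forall>r. C \<inter> proper_transform (cspan2 a b) (cspan2 (p r) (q r)) \<noteq> {})"
    then obtain n' where n': "n' \<noteq> 0" "C = zero_curve n'"
      by (auto simp: curve11_iff)
    then have "\<forall>r. biform n' (s r) (t r) (\<sigma> r) (\<tau> r) = 0"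
      using C by (simp add: meets_iff)
    then show "C = zero_curve n"
      using zero_curves_eq[OF n(1) n'(1) n(2)] n'(2) by simp
  qed
qed

end

definition nat_of_4 :: "4 \<Rightarrow> nat" where
  "nat_of_4 r = (if r = 1 then 1 else if r = 2 then 2 else if r = 3 then 3 else 4)"

lemma nat_of_4_simps: "nat_of_4 1 = 1" "nat_of_4 2 = 2" "nat_of_4 3 = 3" "nat_of_4 4 = 4"
  unfolding nat_of_4_def by simp_all

lemma range_nat_of_4: "range nat_of_4 = {1..4}"
proof -
  have "{1..4::nat} = {1, 2, 3, 4}"
    by (auto simp: numeral_eq_Suc)
  then show ?thesis
    unfolding UNIV_4 by (simp add: nat_of_4_simps)
qed

lemma inj_nat_of_4: "inj nat_of_4"
proof (rule injI)
  fix r r' :: 4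
  assume "nat_of_4 r = nat_of_4 r'"
  then show "r = r'"
    using exhaust_4[of r] exhaust_4[of r'] by (elim disjE) (simp_all add: nat_of_4_simps)
qed

lemma ball_nat_of_4: "(\<forall>i\<in>{1..4}. P i) \<longleftrightarrow> (\<forall>r. P (nat_of_4 r))"
  unfolding range_nat_of_4[symmetric] by simp

theorem lemma6p13:
  fixes ls :: "nat \<Rightarrow> (complex^4) set" and l :: "(complex^4) set"
  assumes lines: "\<forall>i\<in>{1..4}. is_line (ls i)"
    and skew: "\<forall>i\<in>{1..4}. \<forall>j\<in>{1..4}. i \<noteq> j \<longrightarrow> \<not> meets (ls i) (ls j)"
    and l_line: "is_line l"
    and l_meets: "\<forall>i\<in>{1..4}. meets l (ls i)"
    and l_unique: "\<forall>L. is_line L \<and> (\<forall>i\<in>{1..4}. meets L (ls i)) \<longrightarrow> L = l"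
  shows "\<exists>!C. curve11 l C \<and> (\<forall>i\<in>{1..4}. C \<inter> proper_transform l (ls i) \<noteq> {})"
proof -
  obtain a b where l: "indep a b" "l = cspan2 a b"
    using l_line by (auto simp: is_line_iff)
  obtain c d ea eb ec ed where "dual_frame a b c d ea eb ec ed"
    using dual_frame_exists[OF l(1)] by blast
  define L where "L r = ls (nat_of_4 r)" for r
  have skew_L: "\<not> meets (L r) (L r')" if "r \<noteq> r'" for r r'
    using skew that unfolding ball_nat_of_4 L_def by (simp add: inj_eq[OF inj_nat_of_4])
  have "\<exists>p q. \<forall>r. p r \<in> cspan2 a b \<and> p r \<noteq> 0 \<and> q r \<notin> cspan2 a b \<and> L r = cspan2 (p r) (q r)"
  proof (rule skew_lines_meeting_cspan2_decomp)
    show "is_line (L r)" "meets (cspan2 a b) (L r)" for r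
      using lines l_meets l(2) unfolding ball_nat_of_4 L_def by simp_all
  qed (rule skew_L)
  then obtain p q where pq: "\<forall>r. p r \<in> cspan2 a b \<and> p r \<noteq> 0 \<and> q r \<notin> cspan2 a b \<and> L r = cspan2 (p r) (q r)"
    by blast
  interpret four_transversals a b c d ea eb ec ed p q
    by (intro four_transversals.intro four_transversals_axioms.intro \<open>dual_frame a b c d ea eb ec ed\<close>)
      (use pq skew_L in auto)
  have "\<exists>!C. curve11 l C \<and> (\<forall>r. C \<inter> proper_transform l (L r) \<noteq> {})"
    using unique_curve l_unique pq l(2) unfolding ball_nat_of_4 L_def by simp
  then show ?thesis
    unfolding ball_nat_of_4 L_def .
qed

end
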